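(* Let $\lambda>0$ and let $Q$ be a probability distribution on $\mathbb{N}=\{1,2,\ldots\}$. If $Q$ and the compound Poisson distribution $\mathrm{CPo}(\lambda,Q)$ are both log-concave, then $$H(\mathrm{CPo}(\lambda,Q))=\max\big\{H(C_QP)\;:\;P\text{ an ultra log-concave distribution on }\mathbb{Z}_+\text{ with mean }\lambda\big\}.$$
   Context: All distributions are probability mass functions on $\mathbb{Z}_+=\{0,1,2,\ldots\}$; a distribution on $\mathbb{N}=\{1,2,\ldots\}$ is regarded as a distribution on $\mathbb{Z}_+$ with mass $0$ at $0$. $H(P)=-\sum_x P(x)\log P(x)$ is the discrete entropy (natural logarithm, $0\log 0=0$). A distribution $P$ on $\mathbb{Z}_+$ is log-concave if its support is a (possibly infinite) interval of successive integers and $P(x)^2\ge P(x+1)P(x-1)$ for all $x\ge 1$. It is ultra log-concave if its support is a (possibly infinite) interval of successive integers and $xP(x)^2\ge (x+1)P(x+1)P(x-1)$ for all $x\ge 1$ (equivalently, the ratio of $P$ to a Poisson mass function is log-concave). For a distribution $P$ on $\mathbb{Z}_+$ and a distribution $Q$ on $\mathbb{N}$, the $Q$-compound distribution is $C_QP(x)=\sum_{y=0}^\infty P(y)Q^{*y}(x)$, $x\ge 0$, where $Q^{*y}$ is the $y$-th convolution power of $Q$ and $Q^{*0}$ is the point mass at $0$. With $\Pi_\lambda(x)=e^{-\lambda}\lambda^x/x!$ the Poisson mass function, $\mathrm{CPo}(\lambda,Q)$ is the distribution $C_Q\Pi_\lambda$. *)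

theory Defs
  imports "HOL-Probability.Probability"
begin

text \<open>Distributions on the non-negative integers are elements of \<^typ>\<open>nat pmf\<close>; a
  distribution \<open>Q\<close> on the positive integers is one with \<^prop>\<open>pmf Q 0 = 0\<close>.\<close>

definition interval_support :: "nat pmf \<Rightarrow> bool" where
  "interval_support P \<longleftrightarrow> (\<forall>x\<in>set_pmf P. \<forall>z\<in>set_pmf P. {x..z} \<subseteq> set_pmf P)"

definition log_concave :: "nat pmf \<Rightarrow> bool" where
  "log_concave P \<longleftrightarrow> interval_support P \<and>
     (\<forall>x\<ge>1. (pmf P x)\<^sup>2 \<ge> pmf P (x + 1) * pmf P (x - 1))"

definition ultra_log_concave :: "nat pmf \<Rightarrow> bool" where
  "ultra_log_concave P \<longleftrightarrow> interval_support P \<and>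
     (\<forall>x\<ge>1. real x * (pmf P x)\<^sup>2 \<ge> real (x + 1) * pmf P (x + 1) * pmf P (x - 1))"

definition has_mean :: "nat pmf \<Rightarrow> real \<Rightarrow> bool" where
  "has_mean P m \<longleftrightarrow> integrable (measure_pmf P) real \<and> measure_pmf.expectation P real = m"

text \<open>The entropy is a sum of non-negative terms and may be infinite, so it takes values in
  \<^typ>\<open>ennreal\<close>. Since \<^prop>\<open>ln (0::real) = 0\<close>, the convention \<open>0 log 0 = 0\<close> holds.\<close>

definition pmf_entropy :: "nat pmf \<Rightarrow> ennreal" where
  "pmf_entropy P = (\<Sum>x. ennreal (- (pmf P x * ln (pmf P x))))"

definition convolution :: "nat pmf \<Rightarrow> nat pmf \<Rightarrow> nat pmf" where
  "convolution P Q = map_pmf (\<lambda>(a, b). a + b) (pair_pmf P Q)"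

primrec conv_power :: "nat pmf \<Rightarrow> nat \<Rightarrow> nat pmf" where
  "conv_power Q 0 = return_pmf 0"
| "conv_power Q (Suc n) = convolution Q (conv_power Q n)"

text \<open>As mass functions, convolution and compounding are given by the usual sums; see
  \<open>pmf_convolution\<close> and \<open>pmf_compound\<close> below.\<close>

definition compound :: "nat pmf \<Rightarrow> nat pmf \<Rightarrow> nat pmf" where
  "compound Q P = bind_pmf P (conv_power Q)"

definition compound_poisson :: "real \<Rightarrow> nat pmf \<Rightarrow> nat pmf" where
  "compound_poisson l Q = compound Q (poisson_pmf l)"

text \<open>\<^const>\<open>Max\<close> is only meaningful on finite sets, hence a predicate for the maximum of a set.\<close>

definition is_maximum :: "'a::order \<Rightarrow> 'a set \<Rightarrow> bool" where
  "is_maximum m S \<longleftrightarrow> m \<in> S \<and> (\<forall>h\<in>S. h \<le> m)"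

lemma entropy_term_nonneg: "0 \<le> - (pmf P x * ln (pmf P x))"
proof (cases "pmf P x = 0")
  case False
  then have "ln (pmf P x) \<le> 0"
    using pmf_nonneg[of P x] pmf_le_1[of P x] by (simp add: ln_le_zero_iff order_less_le)
  then show ?thesis
    by (simp add: mult_nonneg_nonpos)
qed auto

lemma pmf_entropy_eq_suminf:
  assumes "summable (\<lambda>x. pmf P x * ln (pmf P x))"
  shows "pmf_entropy P = ennreal (- (\<Sum>x. pmf P x * ln (pmf P x)))"
  unfolding pmf_entropy_def
  using assms entropy_term_nonneg by (subst suminf_ennreal2) (auto simp: suminf_minus intro: summable_minus)

lemma pmf_convolution: "pmf (convolution P Q) x = (\<Sum>i\<le>x. pmf P i * pmf Q (x - i))"
proof -
  have eq: "(\<lambda>(a, b). a + b) -` {x} = (\<lambda>i. (i, x - i)) ` {..x}"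
    by (auto simp: image_iff)
  have "pmf (convolution P Q) x = measure (pair_pmf P Q) ((\<lambda>i. (i, x - i)) ` {..x})"
    by (simp add: convolution_def pmf_map eq)
  also have "\<dots> = (\<Sum>z\<in>(\<lambda>i. (i, x - i)) ` {..x}. pmf (pair_pmf P Q) z)"
    by (rule measure_measure_pmf_finite) simp
  also have "\<dots> = (\<Sum>i\<le>x. pmf P i * pmf Q (x - i))"
    by (subst sum.reindex) (auto simp: inj_on_def pmf_pair)
  finally show ?thesis .
qed

lemma pmf_compound: "(\<lambda>y. pmf P y * pmf (conv_power Q y) x) sums pmf (compound Q P) x"
proof -
  have int: "integrable (count_space UNIV) (\<lambda>y. pmf P y * pmf (conv_power Q y) x)"
  proof (rule Bochner_Integration.integrable_bound[OF integrable_pmf[of UNIV P]])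
    show "AE y in count_space UNIV. norm (pmf P y * pmf (conv_power Q y) x) \<le> norm (pmf P y)"
      by (auto simp: abs_mult pmf_le_1 intro!: mult_left_le)
  qed simp
  have "pmf (compound Q P) x = measure_pmf.expectation P (\<lambda>y. pmf (conv_power Q y) x)"
    by (simp add: compound_def pmf_bind)
  also have "\<dots> = (\<integral>y. pmf P y * pmf (conv_power Q y) x \<partial>count_space UNIV)"
    by (subst measure_pmf_eq_density, subst integral_density) auto
  finally show ?thesis
    using sums_integral_count_space_nat[OF int] by simp
qed

end

theory Submission
  imports Defs
begin

text \<open>Let \<open>R\<close> be the compound Poisson distribution and \<open>f = - ln R\<close>, a finite convex function
  because \<open>R\<close> is log-concave with full support. With \<open>S\<^sub>n\<close> a sum of \<open>n\<close> independent copies of \<open>Q\<close>,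
  convexity of \<open>f\<close> makes \<open>h n = E f(S\<^sub>n)\<close> convex in \<open>n\<close>. An ultra log-concave \<open>P\<close> is below the Poisson
  distribution of the same mean in the convex order, so \<open>E h\<close> is larger under the Poisson
  distribution, where it equals \<open>H(R)\<close>, than under \<open>P\<close>, where it is the cross entropy of the
  compound of \<open>P\<close> against \<open>R\<close>; by Gibbs' inequality the latter dominates the entropy of that
  compound.\<close>

section \<open>Discrete convex functions\<close>

text \<open>The increments of \<open>h\<close> grow, so its mean slope on the left of
  \<open>y\<close> is at most \<open>h (y + 1) - h y\<close> and on the right at least that.
  Convexity is demanded only between \<open>x\<close> and \<open>z\<close> because one application
  is to a log-ratio that is meaningful only on a support. The form without division covers
  \<open>x = z\<close>.\<close>

lemma discrete_convex_chord:
  fixes h :: "nat \<Rightarrow> real"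
  assumes conv: "\<And>i. x \<le> i \<Longrightarrow> i + 2 \<le> z \<Longrightarrow> 2 * h (i + 1) \<le> h i + h (i + 2)"
    and "x \<le> y" "y \<le> z"
  shows "real (z - x) * h y \<le> real (z - y) * h x + real (y - x) * h z"
\<comment> \<open>The increment at \<open>y\<close> involves \<open>h (y + 1)\<close>, which
  convexity up to \<open>z\<close> controls only for \<open>y < z\<close>.\<close>
proof (cases "y = z")
  case True
  then show ?thesis by simp
next
  case False
  define d where "d i = h (i + 1) - h i" for i
  have d_mono: "d i \<le> d j" if "x \<le> i" "i \<le> j" "j < z" for i j
    using that(2,1,3)
  proof (induction j rule: dec_induct)
    case (step j)
    then show ?case using conv[of j] by (simp add: d_def)
  qed simp
  have left: "h y - h x \<le> real (y - x) * d y"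
  proof -
    have "h y - h x = (\<Sum>i=x..<y. d i)"
      using \<open>x \<le> y\<close> by (simp add: d_def sum_Suc_diff')
    also have "\<dots> \<le> (\<Sum>i=x..<y. d y)"
      using False assms by (intro sum_mono d_mono) auto
    finally show ?thesis by simp
  qed
  have right: "real (z - y) * d y \<le> h z - h y"
  proof -
    have "(\<Sum>i=y..<z. d y) \<le> (\<Sum>i=y..<z. d i)"
      using assms by (intro sum_mono d_mono) auto
    also have "\<dots> = h z - h y"
      using \<open>y \<le> z\<close> by (simp add: d_def sum_Suc_diff')
    finally show ?thesis by simp
  qed
  have "real (z - y) * (h y - h x) \<le> real (z - y) * (real (y - x) * d y)"
    using left by (rule mult_left_mono) simp
  also have "\<dots> \<le> real (y - x) * (h z - h y)"
    using mult_left_mono[OF right, of "real (y - x)"] by (simp add: algebra_simps)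
  finally show ?thesis
    using assms by (simp add: of_nat_diff algebra_simps)
qed

text \<open>The points \<open>s + x\<close> and \<open>s + y\<close> divide the segment from
  \<open>s\<close> to \<open>s + x + y\<close> with complementary weights, so adding the two chord
  inequalities gives the claim.\<close>

lemma discrete_convex_increments:
  fixes h :: "nat \<Rightarrow> real"
  assumes conv: "\<And>i. 2 * h (i + 1) \<le> h i + h (i + 2)"
  shows "h (s + x) + h (s + y) \<le> h s + h (s + x + y)"
proof (cases "x + y = 0")
  case False
  have "real (x + y) * h (s + x) \<le> real y * h s + real x * h (s + x + y)"
    using discrete_convex_chord[of s "s + x + y" h "s + x"] conv by simp
  moreover have "real (x + y) * h (s + y) \<le> real x * h s + real y * h (s + x + y)"
    using discrete_convex_chord[of s "s + x + y" h "s + y"] conv by simp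
  ultimately have "real (x + y) * (h (s + x) + h (s + y)) \<le> real (x + y) * (h s + h (s + x + y))"
    by (simp add: algebra_simps)
  then show ?thesis
    using False by (simp only: mult_le_cancel_left)
qed auto

lemma discrete_convex_chord_signs:
  fixes h :: "nat \<Rightarrow> real"
  assumes conv: "\<And>i. 2 * h (i + 1) \<le> h i + h (i + 2)" and "a \<le> b"
  obtains c d where "\<And>y. a \<le> y \<Longrightarrow> y \<le> b \<Longrightarrow> h y \<le> c + d * real y"
    and "\<And>y. y < a \<or> b < y \<Longrightarrow> c + d * real y \<le> h y"
proof -
  \<comment> \<open>The line is the chord of \<open>h\<close> from \<open>a\<close> to
    \<open>b'\<close>. Here \<open>b' = b\<close> unless \<open>a = b\<close>; in that case the
    chord to \<open>a + 1\<close> still meets \<open>h\<close> at \<open>a\<close> and lies below it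
    elsewhere.\<close>
  define b' where "b' = max b (a + 1)"
  define d where "d = (h b' - h a) / (real b' - real a)"
  have b': "a < b'" "b \<le> b'" by (auto simp: b'_def)
  have scale: "(real b' - real a) * (h a - d * real a + d * real y)
      = (real b' - real y) * h a + (real y - real a) * h b'" for y
  proof -
    have "d * (real b' - real a) = h b' - h a"
      using b' by (simp add: d_def)
    then have "d * (real b' - real a) * (real y - real a) = (h b' - h a) * (real y - real a)"
      by simp
    then show ?thesis by (simp add: algebra_simps)
  qed
  have pos: "0 < real b' - real a" using b' by simp
  show thesis
  proof (rule that[where c = "h a - d * real a" and d = d])
    fix y assume "a \<le> y" "y \<le> b"
    then have "(real b' - real a) * h y \<le> (real b' - real a) * (h a - d * real a + d * real y)"
      using discrete_convex_chord[of a b' h y] conv b' unfolding scale by (simp add: of_nat_diff)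
    then show "h y \<le> h a - d * real a + d * real y"
      using pos by (simp only: mult_le_cancel_left_pos)
  next
    fix y assume "y < a \<or> b < y"
    then have "(real b' - real a) * (h a - d * real a + d * real y) \<le> (real b' - real a) * h y"
    proof
      assume "y < a"
      then show ?thesis
        using discrete_convex_chord[of y b' h a] conv b' unfolding scale
        by (simp add: of_nat_diff algebra_simps)
    next
      assume "b < y"
      then have "b' \<le> y" using \<open>a \<le> b\<close> by (auto simp: b'_def)
      then show ?thesis
        using discrete_convex_chord[of a y h b'] conv b' unfolding scale
        by (simp add: of_nat_diff algebra_simps)
    qed
    then show "h a - d * real a + d * real y \<le> h y"
      using pos by (simp only: mult_le_cancel_left_pos)
  qed
qed

section \<open>Series against mass functions and basic facts on the Poisson distribution\<close>

lemma sums_pmf_nat: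
  fixes P :: "nat pmf"
  shows "pmf P sums 1"
  using sums_integral_count_space_nat[OF integrable_pmf[of UNIV P]]
  by (simp add: integral_pmf)

lemma has_mean_sums:
  assumes "has_mean P m"
  shows "(\<lambda>y. pmf P y * real y) sums m"
proof -
  have "integrable (count_space UNIV) (\<lambda>y. pmf P y * real y)"
    using assms by (simp add: has_mean_def measure_pmf_eq_density integrable_density)
  from sums_integral_count_space_nat[OF this] show ?thesis
    using assms by (simp add: has_mean_def measure_pmf_eq_density integral_density)
qed

lemma nn_integral_pmf_suminf:
  fixes P :: "nat pmf"
  shows "(\<integral>\<^sup>+x. f x \<partial>measure_pmf P) = (\<Sum>x. ennreal (pmf P x) * f x)"
  by (simp add: nn_integral_measure_pmf nn_integral_count_space_nat)

lemma nn_integral_pmf_real_suminf: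
  fixes P :: "nat pmf"
  assumes "\<And>x. 0 \<le> f x" "summable (\<lambda>x. pmf P x * f x)"
  shows "(\<integral>\<^sup>+x. ennreal (f x) \<partial>measure_pmf P) = ennreal (\<Sum>x. pmf P x * f x)"
  using assms by (simp add: nn_integral_pmf_suminf suminf_ennreal2 flip: ennreal_mult)

text \<open>This recursion stands in for the factorial formula below, hence the recurrent
  \<open>del: pmf_poisson\<close>.\<close>

lemma poisson_ratio:
  assumes "0 < l"
  shows "pmf (poisson_pmf l) (Suc n) = pmf (poisson_pmf l) n * l / real (Suc n)"
  using assms by (simp add: field_simps)

text \<open>The Poisson distribution is the case of equality: by the ratio, both sides are
  \<open>l\<close> times the product of the masses at \<open>x\<close> and
  \<open>x - 1\<close>.\<close>

lemma ultra_log_concave_poisson: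
  assumes "0 < l"
  shows "ultra_log_concave (poisson_pmf l)"
  unfolding ultra_log_concave_def
proof (intro conjI allI impI)
  show "interval_support (poisson_pmf l)"
    using assms by (simp add: interval_support_def)
  fix x :: nat assume "1 \<le> x"
  then obtain n where x: "x = Suc n" by (cases x) auto
  show "real x * (pmf (poisson_pmf l) x)\<^sup>2 \<ge> real (x + 1) * pmf (poisson_pmf l) (x + 1) * pmf (poisson_pmf l) (x - 1)"
    using assms by (simp add: x poisson_ratio power2_eq_square mult_ac del: pmf_poisson)
qed

text \<open>By the ratio, the term of the mean series at \<open>n + 1\<close> is \<open>l\<close>
  times the mass at \<open>n\<close>; the term at 0 vanishes, so the series sums to \<open>l\<close>
  times the total mass.\<close>

lemma has_mean_poisson:
  assumes "0 < l"
  shows "has_mean (poisson_pmf l) l"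
proof -
  have "(\<lambda>n. pmf (poisson_pmf l) n * l) sums (1 * l)"
    by (intro sums_mult2 sums_pmf_nat)
  then have "(\<lambda>n. pmf (poisson_pmf l) (Suc n) * real (Suc n)) sums l"
    using poisson_ratio[OF assms] by simp
  then have s: "(\<lambda>n. pmf (poisson_pmf l) n * real n) sums l"
    using sums_Suc_iff[of "\<lambda>n. pmf (poisson_pmf l) n * real n" l] by simp
  have "(\<integral>\<^sup>+x. ennreal (real x) \<partial>measure_pmf (poisson_pmf l)) = ennreal l"
    using s by (subst nn_integral_pmf_real_suminf) (auto simp: sums_iff)
  then have "has_bochner_integral (measure_pmf (poisson_pmf l)) real l"
    using assms by (intro has_bochner_integral_nn_integral) auto
  then show ?thesis
    by (auto simp: has_mean_def has_bochner_integral_iff)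
qed

section \<open>Convex order against the Poisson distribution\<close>

text \<open>Ultra log-concavity of \<open>P\<close> says that the logarithm of the ratio of the
  Poisson mass to that of \<open>P\<close> is convex. Being nonpositive at \<open>x\<close> and
  \<open>z\<close>, it is nonpositive in between.\<close>

lemma ultra_log_concave_ge_poisson_between:
  assumes "ultra_log_concave P" "0 < l"
    and "pmf (poisson_pmf l) x \<le> pmf P x" "pmf (poisson_pmf l) z \<le> pmf P z" "x \<le> y" "y \<le> z"
  shows "pmf (poisson_pmf l) y \<le> pmf P y"
proof -
  let ?R = "poisson_pmf l"
  have Rpos: "0 < pmf ?R i" for i using \<open>0 < l\<close> by (simp add: pmf_positive_iff)
  \<comment> \<open>Domination of a positive mass puts both ends in the support of \<open>P\<close>;
    the interval property then keeps every logarithm between them away from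
    \<open>ln 0\<close>.\<close>
  have "x \<in> set_pmf P" "z \<in> set_pmf P"
    using assms(3,4) Rpos[of x] Rpos[of z] by (auto simp: set_pmf_iff)
  then have supp: "{x..z} \<subseteq> set_pmf P"
    using assms(1) unfolding ultra_log_concave_def interval_support_def by blast
  have Ppos: "0 < pmf P i" if "x \<le> i" "i \<le> z" for i
    using supp that by (auto simp: pmf_positive_iff)
  define h where "h i = ln (pmf ?R i) - ln (pmf P i)" for i
  have conv: "2 * h (i + 1) \<le> h i + h (i + 2)" if i: "x \<le> i" "i + 2 \<le> z" for i
  proof -
    have pos: "0 < pmf P i" "0 < pmf P (i + 1)" "0 < pmf P (i + 2)"
      using i by (auto intro!: Ppos)
    have "real (i + 2) * pmf P (i + 2) * pmf P i \<le> real (i + 1) * (pmf P (i + 1))\<^sup>2"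
      using assms(1) unfolding ultra_log_concave_def by (auto dest!: spec[of _ "i + 1"])
    then have "ln (real (i + 2) * pmf P (i + 2) * pmf P i) \<le> ln (real (i + 1) * (pmf P (i + 1))\<^sup>2)"
      using pos by (subst ln_le_cancel_iff) auto
    then have 1: "ln (real (i + 2)) + ln (pmf P (i + 2)) + ln (pmf P i)
        \<le> ln (real (i + 1)) + 2 * ln (pmf P (i + 1))"
      using pos by (simp add: ln_mult ln_realpow)
    have 2: "ln (pmf ?R (Suc j)) = ln (pmf ?R j) + ln l - ln (real (Suc j))" for j
      unfolding poisson_ratio[OF \<open>0 < l\<close>]
      using Rpos[of j] \<open>0 < l\<close> by (simp add: ln_mult ln_div del: pmf_poisson)
    from 1 2[of i] 2[of "Suc i"] show ?thesis by (simp add: h_def del: pmf_poisson)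
  qed
  have sgn: "h i \<le> 0 \<longleftrightarrow> pmf ?R i \<le> pmf P i" if "x \<le> i" "i \<le> z" for i
    using Rpos[of i] Ppos[OF that] by (simp add: h_def del: pmf_poisson)
  show ?thesis
  proof (cases "x = z")
    case False
    have "real (z - x) * h y \<le> real (z - y) * h x + real (y - x) * h z"
      using conv assms by (intro discrete_convex_chord) auto
    also have "\<dots> \<le> 0"
      using sgn[of x] sgn[of z] assms by (simp add: add_nonpos_nonpos mult_nonneg_nonpos)
    finally have "h y \<le> 0"
      using False assms by (simp add: mult_le_0_iff)
    then show ?thesis using sgn[of y] assms by simp
  qed (use assms in auto)
qed

text \<open>The set where \<open>P\<close> dominates the Poisson mass function is an interval. If it is bounded,
  subtract from \<open>h\<close> its chord over that interval: both expectations change by the same amount,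
  and the remaining difference has a sign at every point. If it is unbounded, equality of the means
  forces \<open>P\<close> to be Poisson.\<close>

lemma ultra_log_concave_convex_order:
  assumes ulc: "ultra_log_concave P" and mean: "has_mean P l" and "0 < l"
    and conv: "\<And>i. 2 * h (i + 1) \<le> h i + h (i + 2)"
    and nonneg: "\<And>i. 0 \<le> h i"
    and sumR: "summable (\<lambda>i. pmf (poisson_pmf l) i * h i)"
  shows "(\<integral>\<^sup>+i. ennreal (h i) \<partial>measure_pmf P) \<le> (\<integral>\<^sup>+i. ennreal (h i) \<partial>measure_pmf (poisson_pmf l))"
proof -
  let ?R = "poisson_pmf l"
  define S where "S = {i. pmf ?R i \<le> pmf P i}"
  have P1: "pmf P sums 1" and R1: "pmf ?R sums 1"
    by (rule sums_pmf_nat)+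
  have Pm: "(\<lambda>i. pmf P i * real i) sums l" and Rm: "(\<lambda>i. pmf ?R i * real i) sums l"
    using has_mean_sums[OF mean] has_mean_sums[OF has_mean_poisson[OF \<open>0 < l\<close>]] by auto
  have affP: "(\<lambda>i. pmf P i * (c + d * real i)) sums (c + d * l)" for c d
    using sums_add[OF sums_mult2[OF P1, of c] sums_mult2[OF Pm, of d]] by (simp add: algebra_simps)
  have affR: "(\<lambda>i. pmf ?R i * (c + d * real i)) sums (c + d * l)" for c d
    using sums_add[OF sums_mult2[OF R1, of c] sums_mult2[OF Rm, of d]]
    by (simp add: algebra_simps del: pmf_poisson)
  have "S \<noteq> {}"
  proof
    assume "S = {}"
    then have less: "pmf P i < pmf ?R i" for i by (auto simp: S_def not_le simp del: pmf_poisson)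
    have "(\<lambda>i. pmf ?R i - pmf P i) sums 0"
      using sums_diff[OF R1 P1] by simp
    then have "(\<Sum>i. pmf ?R i - pmf P i) = 0" "summable (\<lambda>i. pmf ?R i - pmf P i)"
      by (auto simp: sums_iff)
    then have "\<forall>i. pmf ?R i - pmf P i = 0"
      using less by (subst (asm) suminf_eq_zero_iff) (auto simp: less_imp_le simp del: pmf_poisson)
    then show False using less[of 0] by simp
  qed
  define a where "a = (LEAST i. i \<in> S)"
  have a: "a \<in> S" "\<And>i. i \<in> S \<Longrightarrow> a \<le> i"
    using \<open>S \<noteq> {}\<close> by (auto simp: a_def intro: LeastI Least_le)
  have between: "y \<in> S" if "a \<le> y" "y \<le> z" "z \<in> S" for y z
    using ultra_log_concave_ge_poisson_between[OF ulc \<open>0 < l\<close>, of a z y] that a by (simp add: S_def)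
  show ?thesis
  proof (cases "finite S")
    case True
    define b where "b = Max S"
    have b: "b \<in> S" "\<And>i. i \<in> S \<Longrightarrow> i \<le> b"
      using True \<open>S \<noteq> {}\<close> by (auto simp: b_def)
    have S: "i \<in> S \<longleftrightarrow> a \<le> i \<and> i \<le> b" for i
      using a b between by blast
    obtain c d where cd: "\<And>y. a \<le> y \<Longrightarrow> y \<le> b \<Longrightarrow> h y \<le> c + d * real y"
        "\<And>y. y < a \<or> b < y \<Longrightarrow> c + d * real y \<le> h y"
      using discrete_convex_chord_signs[of h a b] conv a(2)[OF b(1)] by metis
    define L where "L i = c + d * real i" for i
    have sign: "(pmf P i - pmf ?R i) * (h i - L i) \<le> 0" for i
    proof (cases "i \<in> S")
      case True
      then show ?thesis
        using cd(1)[of i] S[of i] by (intro mult_nonneg_nonpos) (auto simp: S_def L_def simp del: pmf_poisson)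
    next
      case False
      then show ?thesis
        using cd(2)[of i] S[of i] by (intro mult_nonpos_nonneg) (auto simp: S_def L_def simp del: pmf_poisson)
    qed
    \<comment> \<open>By the sign condition \<open>g\<close> majorizes the terms of the expectation
      under \<open>P\<close>. Its affine part sums to 0, as masses and means agree. The comparison
      also yields the summability under \<open>P\<close>, which is not known beforehand.\<close>
    define g where "g i = pmf ?R i * h i + (pmf P i * L i - pmf ?R i * L i)" for i
    have g: "g sums ((\<Sum>i. pmf ?R i * h i) + (c + d * l - (c + d * l)))"
      unfolding g_def L_def by (intro sums_add sums_diff affP affR summable_sums sumR)
    have le: "pmf P i * h i \<le> g i" for i
      using sign[of i] by (simp add: g_def algebra_simps del: pmf_poisson)
    have sumP: "summable (\<lambda>i. pmf P i * h i)"
    proof (rule summable_comparison_test')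
      show "summable g" using g by (rule sums_summable)
      show "norm (pmf P i * h i) \<le> g i" if "0 \<le> i" for i
        using le[of i] nonneg[of i] by simp
    qed
    have "(\<Sum>i. pmf P i * h i) \<le> (\<Sum>i. g i)"
      by (intro suminf_le le sumP sums_summable[OF g])
    also have "\<dots> = (\<Sum>i. pmf ?R i * h i)"
      using sums_unique[OF g] by simp
    finally show ?thesis
      unfolding nn_integral_pmf_real_suminf[of h, OF nonneg sumP]
        nn_integral_pmf_real_suminf[of h, OF nonneg sumR]
      by (rule ennreal_leI)
  next
    case False
    have S: "i \<in> S \<longleftrightarrow> a \<le> i" for i
    proof
      assume "a \<le> i"
      obtain z where "z \<in> S" "i < z"
        using False by (meson finite_nat_set_iff_bounded_le not_le)
      then show "i \<in> S" using between[of i z] \<open>a \<le> i\<close> by simp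
    qed (use a in auto)
    \<comment> \<open>Both factors change sign together at \<open>a\<close>, so all terms are
      nonnegative, while equal masses and means make the sum 0. Hence the masses agree off
      \<open>a\<close>, and at \<open>a\<close> by normalization.\<close>
    define t where "t i = (pmf P i - pmf ?R i) * (real i - real a)" for i
    have t0: "0 \<le> t i" for i
    proof (cases "a \<le> i")
      case True
      then show ?thesis
        using S[of i] by (auto simp: t_def S_def simp del: pmf_poisson intro!: mult_nonneg_nonneg)
    next
      case False
      then show ?thesis
        using S[of i] by (auto simp: t_def S_def simp del: pmf_poisson intro!: mult_nonpos_nonpos)
    qed
    have "t sums 0"
      using sums_diff[OF affP[of "- real a" 1] affR[of "- real a" 1]]
      by (simp add: t_def[abs_def] algebra_simps del: pmf_poisson)
    then have "\<forall>i. t i = 0"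
      using t0 suminf_eq_zero_iff[of t] by (auto simp: sums_iff)
    then have eq: "pmf P i = pmf ?R i" if "i \<noteq> a" for i
      using that by (auto simp: t_def simp del: pmf_poisson)
    have "(\<lambda>i. pmf P i - pmf ?R i) sums (pmf P a - pmf ?R a)"
      using sums_finite[of "{a}" "\<lambda>i. pmf P i - pmf ?R i"] eq by (simp del: pmf_poisson)
    moreover have "(\<lambda>i. pmf P i - pmf ?R i) sums 0"
      using sums_diff[OF P1 R1] by simp
    ultimately have "pmf P a = pmf ?R a"
      using sums_unique2 by fastforce
    then have "P = ?R"
      using eq by (intro pmf_eqI) metis
    then show ?thesis by simp
  qed
qed

section \<open>Entropy and cross entropy\<close>

lemma pmf_entropy_eq_nn_integral:
  "pmf_entropy P = (\<integral>\<^sup>+x. ennreal (- ln (pmf P x)) \<partial>measure_pmf P)"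
proof -
  have "ennreal (pmf P x) * ennreal (- ln (pmf P x)) = ennreal (- (pmf P x * ln (pmf P x)))" for x
    by (simp flip: ennreal_mult')
  then show ?thesis
    by (simp add: pmf_entropy_def nn_integral_pmf_suminf)
qed

text \<open>Gibbs' inequality, from \<open>ln t \<le> t - 1\<close> at the ratio of the masses. Full
  support matters: at a null point of \<open>R\<close> the value \<open>ln 0 = 0\<close> would
  replace an infinite cost by 0.\<close>

lemma pmf_entropy_le_cross_entropy:
  assumes "set_pmf R = UNIV"
  shows "pmf_entropy P \<le> (\<integral>\<^sup>+x. ennreal (- ln (pmf R x)) \<partial>measure_pmf P)"
proof -
  have Rpos: "0 < pmf R x" for x
    using assms by (simp add: pmf_positive_iff)
  have sum1: "(\<Sum>x. ennreal (pmf p x)) = 1" for p :: "nat pmf"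
    using sums_pmf_nat[of p] by (subst suminf_ennreal2) (auto simp: sums_iff)
  have lnR: "0 \<le> - ln (pmf R x)" for x
    using Rpos[of x] pmf_le_1[of R x] by (simp add: ln_le_zero_iff)
  \<comment> \<open>The masses are added rather than subtracted so that every term is nonnegative
    and the series may be infinite; the resulting 1 on each side cancels at the end.\<close>
  have pointwise: "- (pmf P x * ln (pmf P x)) + pmf P x \<le> pmf P x * (- ln (pmf R x)) + pmf R x" for x
  proof (cases "pmf P x = 0")
    case False
    then have Ppos: "0 < pmf P x" by (simp add: pmf_positive_iff set_pmf_iff)
    have "ln (pmf R x / pmf P x) \<le> pmf R x / pmf P x - 1"
      using Rpos Ppos by (intro ln_le_minus_one) simp
    then have "pmf P x * ln (pmf R x / pmf P x) \<le> pmf P x * (pmf R x / pmf P x - 1)"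
      using Ppos by (intro mult_left_mono) auto
    then show ?thesis
      using Ppos Rpos[of x] by (simp add: ln_div algebra_simps)
  qed simp
  have "pmf_entropy P + 1 = (\<Sum>x. ennreal (- (pmf P x * ln (pmf P x))) + ennreal (pmf P x))"
    unfolding pmf_entropy_def sum1[of P, symmetric] by (subst suminf_add) auto
  also have "\<dots> = (\<Sum>x. ennreal (- (pmf P x * ln (pmf P x)) + pmf P x))"
    using entropy_term_nonneg by (intro suminf_cong ennreal_plus[symmetric]) auto
  also have "\<dots> \<le> (\<Sum>x. ennreal (pmf P x * (- ln (pmf R x)) + pmf R x))"
    using pointwise by (intro suminf_le ennreal_leI) auto
  also have "\<dots> = (\<Sum>x. ennreal (pmf P x) * ennreal (- ln (pmf R x)) + ennreal (pmf R x))"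
    using lnR by (intro suminf_cong) (simp only: ennreal_plus ennreal_mult mult_nonneg_nonneg pmf_nonneg)
  also have "\<dots> = (\<integral>\<^sup>+x. ennreal (- ln (pmf R x)) \<partial>measure_pmf P) + 1"
    unfolding nn_integral_pmf_suminf sum1[of R, symmetric] by (subst suminf_add) auto
  finally show ?thesis by (simp add: add.commute[of _ 1] ennreal_add_left_cancel_le)
qed

section \<open>Integrals over convolution powers and compounds\<close>

lemma nn_integral_conv_power_Suc:
  "(\<integral>\<^sup>+x. f x \<partial>measure_pmf (conv_power Q (Suc n)))
    = (\<integral>\<^sup>+x. \<integral>\<^sup>+s. f (x + s) \<partial>measure_pmf (conv_power Q n) \<partial>measure_pmf Q)"
  by (simp add: convolution_def nn_integral_pair_pmf')

lemma nn_integral_compound: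
  "(\<integral>\<^sup>+x. f x \<partial>measure_pmf (compound Q P))
    = (\<integral>\<^sup>+n. \<integral>\<^sup>+x. f x \<partial>measure_pmf (conv_power Q n) \<partial>measure_pmf P)"
  by (simp add: compound_def)

text \<open>With \<open>s\<close> a sum of \<open>n\<close> copies of \<open>Q\<close> and
  \<open>x\<close>, \<open>y\<close> two further independent copies, the increment inequality for
  \<open>f\<close> is integrated over all three. Values in \<open>ennreal\<close> make this work
  without integrability.\<close>

lemma nn_integral_conv_power_convex:
  fixes f :: "nat \<Rightarrow> real" and Q :: "nat pmf"
  assumes conv: "\<And>i. 2 * f (i + 1) \<le> f i + f (i + 2)" and nonneg: "\<And>i. 0 \<le> f i"
  defines "h \<equiv> \<lambda>n. \<integral>\<^sup>+x. ennreal (f x) \<partial>measure_pmf (conv_power Q n)"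
  shows "2 * h (n + 1) \<le> h n + h (n + 2)"
proof -
  let ?C = "measure_pmf (conv_power Q n)" and ?Q = "measure_pmf Q"
  have const: "(\<integral>\<^sup>+x. c \<partial>?Q) = c" for c :: ennreal
    by (simp add: measure_pmf.emeasure_space_1)
  \<comment> \<open>Each copy of \<open>h (n + 1)\<close> gets one idle integration, over
    \<open>y\<close> or over \<open>x\<close>, so that the integrands can be added.\<close>
  have "2 * h (n + 1) = (\<integral>\<^sup>+x. \<integral>\<^sup>+y. \<integral>\<^sup>+s. ennreal (f (s + x)) \<partial>?C \<partial>?Q \<partial>?Q)
      + (\<integral>\<^sup>+x. \<integral>\<^sup>+y. \<integral>\<^sup>+s. ennreal (f (s + y)) \<partial>?C \<partial>?Q \<partial>?Q)"
    unfolding h_def const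
    by (simp add: nn_integral_conv_power_Suc const add.commute mult_2 del: conv_power.simps)
  also have "\<dots> = (\<integral>\<^sup>+x. \<integral>\<^sup>+y. \<integral>\<^sup>+s. ennreal (f (s + x) + f (s + y)) \<partial>?C \<partial>?Q \<partial>?Q)"
    using nonneg by (simp add: ennreal_plus nn_integral_add)
  also have "\<dots> \<le> (\<integral>\<^sup>+x. \<integral>\<^sup>+y. \<integral>\<^sup>+s. ennreal (f s + f (s + x + y)) \<partial>?C \<partial>?Q \<partial>?Q)"
    by (intro nn_integral_mono ennreal_leI discrete_convex_increments conv)
  also have "\<dots> = h n + (\<integral>\<^sup>+x. \<integral>\<^sup>+y. \<integral>\<^sup>+s. ennreal (f (s + x + y)) \<partial>?C \<partial>?Q \<partial>?Q)"
    using nonneg by (simp add: ennreal_plus nn_integral_add const h_def)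
  also have "(\<integral>\<^sup>+x. \<integral>\<^sup>+y. \<integral>\<^sup>+s. ennreal (f (s + x + y)) \<partial>?C \<partial>?Q \<partial>?Q) = h (n + 2)"
    unfolding h_def
    by (simp add: nn_integral_conv_power_Suc add.commute add.left_commute numeral_2_eq_2 del: conv_power.simps)
  finally show ?thesis .
qed

section \<open>Full support, and convexity of the negative log mass\<close>

text \<open>If \<open>Q\<close> charges \<open>q \<ge> 1\<close>, then all multiples of
  \<open>q\<close> are charged, since the Poisson distribution charges every number of summands; the
  interval property fills the gaps.\<close>

lemma set_compound_poisson_UNIV:
  assumes "0 < l" "pmf Q 0 = 0" "interval_support (compound_poisson l Q)"
  shows "set_pmf (compound_poisson l Q) = UNIV"
proof -
  obtain q where q: "q \<in> set_pmf Q"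
    using set_pmf_not_empty[of Q] by blast
  then have "1 \<le> q"
    using assms(2) by (cases q) (auto simp: set_pmf_iff)
  have mult: "n * q \<in> set_pmf (conv_power Q n)" for n
    using q by (induction n) (auto simp: convolution_def intro!: image_eqI[of _ _ "(q, _)"])
  have supp: "n * q \<in> set_pmf (compound_poisson l Q)" for n
    using mult assms(1) by (auto simp: compound_poisson_def compound_def)
  have "x \<in> set_pmf (compound_poisson l Q)" for x
  proof -
    have "{0..x * q} \<subseteq> set_pmf (compound_poisson l Q)"
      using assms(3) supp[of 0] supp[of x] unfolding interval_support_def by auto
    then show ?thesis
      using \<open>1 \<le> q\<close> by (auto simp: subset_iff)
  qed
  then show ?thesis by auto
qed

lemma log_concave_neg_ln_convex:
  assumes "log_concave R" "set_pmf R = UNIV"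
  shows "2 * - ln (pmf R (i + 1)) \<le> - ln (pmf R i) + - ln (pmf R (i + 2))"
proof -
  have pos: "0 < pmf R j" for j
    using assms(2) by (simp add: pmf_positive_iff)
  have "pmf R (i + 2) * pmf R i \<le> (pmf R (i + 1))\<^sup>2"
    using assms(1) unfolding log_concave_def by (auto dest!: spec[of _ "i + 1"])
  then have "ln (pmf R (i + 2) * pmf R i) \<le> ln ((pmf R (i + 1))\<^sup>2)"
    using pos[of i] pos[of "i + 1"] pos[of "i + 2"] by (subst ln_le_cancel_iff) auto
  then show ?thesis
    using pos[of i] pos[of "i + 1"] pos[of "i + 2"] by (simp add: ln_mult ln_realpow)
qed

section \<open>The maximum of the entropy\<close>

lemma entropy_compound_le_compound_poisson:
  assumes "0 < l" "pmf Q 0 = 0" "log_concave (compound_poisson l Q)"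
    and "ultra_log_concave P" "has_mean P l"
  shows "pmf_entropy (compound Q P) \<le> pmf_entropy (compound_poisson l Q)"
proof (cases "pmf_entropy (compound_poisson l Q) = \<infinity>")
  case False
  let ?R = "poisson_pmf l" and ?C = "compound_poisson l Q"
  define f where "f x = - ln (pmf ?C x)" for x
  define h where "h n = (\<integral>\<^sup>+x. ennreal (f x) \<partial>measure_pmf (conv_power Q n))" for n
  have full: "set_pmf ?C = UNIV"
    using assms by (intro set_compound_poisson_UNIV) (auto simp: log_concave_def)
  have f0: "0 \<le> f x" for x
    using full pmf_le_1[of ?C x] by (simp add: f_def ln_le_zero_iff pmf_positive_iff)
  have fconv: "2 * f (i + 1) \<le> f i + f (i + 2)" for i
    unfolding f_def using assms(3) full by (rule log_concave_neg_ln_convex)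
  have cross: "(\<integral>\<^sup>+x. ennreal (f x) \<partial>measure_pmf (compound Q p)) = (\<integral>\<^sup>+n. h n \<partial>measure_pmf p)" for p
    by (simp add: nn_integral_compound h_def)
  have ent: "pmf_entropy ?C = (\<integral>\<^sup>+n. h n \<partial>measure_pmf ?R)"
    unfolding pmf_entropy_eq_nn_integral f_def[symmetric]
    using cross[of ?R] by (simp only: compound_poisson_def)
  \<comment> \<open>A finite integral makes \<open>h\<close> finite almost everywhere, and the
    Poisson distribution has no null points. This allows the passage to the real function
    \<open>k\<close> that the convex order comparison requires.\<close>
  have hfin: "h n < \<infinity>" for n
  proof -
    have "AE n in measure_pmf ?R. h n \<noteq> \<infinity>"
      using False ent by (intro nn_integral_PInf_AE) auto
    then show ?thesis using \<open>0 < l\<close> by (auto simp: AE_measure_pmf_iff less_top)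
  qed
  define k where "k n = enn2real (h n)" for n
  have hk: "h n = ennreal (k n)" for n
    using hfin[of n] by (simp add: k_def)
  have k0: "0 \<le> k n" for n by (simp add: k_def)
  have kconv: "2 * k (i + 1) \<le> k i + k (i + 2)" for i
  proof -
    have "2 * h (i + 1) \<le> h i + h (i + 2)"
      unfolding h_def using fconv f0 by (rule nn_integral_conv_power_convex)
    then have "ennreal (2 * k (i + 1)) \<le> ennreal (k i + k (i + 2))"
      using k0 by (simp add: hk ennreal_mult ennreal_plus)
    then show ?thesis using k0 by (subst (asm) ennreal_le_iff) (auto intro: add_nonneg_nonneg)
  qed
  have "(\<Sum>n. ennreal (pmf ?R n * k n)) \<noteq> \<infinity>"
    using False ent k0 by (simp add: hk nn_integral_pmf_suminf ennreal_mult del: pmf_poisson)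
  then have sumR: "summable (\<lambda>n. pmf ?R n * k n)"
    using k0 by (intro summable_suminf_not_top) (auto simp del: pmf_poisson)
  have "pmf_entropy (compound Q P) \<le> (\<integral>\<^sup>+n. h n \<partial>measure_pmf P)"
    using pmf_entropy_le_cross_entropy[OF full, of "compound Q P"] cross[of P] by (simp add: f_def)
  also have "\<dots> \<le> (\<integral>\<^sup>+n. h n \<partial>measure_pmf ?R)"
    unfolding hk using assms kconv k0 sumR by (intro ultra_log_concave_convex_order) auto
  finally show ?thesis by (simp add: ent)
qed simp

theorem theorem1p5:
  fixes l :: real and Q :: "nat pmf"
  assumes "l > 0"
    and "pmf Q 0 = 0"
    and "log_concave Q"
    and "log_concave (compound_poisson l Q)"
  shows "is_maximum (pmf_entropy (compound_poisson l Q))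
    {pmf_entropy (compound Q P) |P. ultra_log_concave P \<and> has_mean P l}"
  unfolding is_maximum_def
proof
  show "pmf_entropy (compound_poisson l Q)
      \<in> {pmf_entropy (compound Q P) |P. ultra_log_concave P \<and> has_mean P l}"
    using ultra_log_concave_poisson has_mean_poisson assms(1) by (auto simp: compound_poisson_def)
  show "\<forall>e\<in>{pmf_entropy (compound Q P) |P. ultra_log_concave P \<and> has_mean P l}.
      e \<le> pmf_entropy (compound_poisson l Q)"
    using entropy_compound_le_compound_poisson assms by auto
qed

end
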